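(* Let $\sigma>0$, $p>c>0$ and $N\ge1$. Let $Z_1,Z_2,\dots$ be i.i.d. standard normal random variables and for $\alpha\in[0,1]$, $\kappa\in\mathbb{R}$ put $S_0=0$, $S_n=\sigma\sum_{i=1}^nZ_i-\kappa\sigma n^{\alpha}$ for $n\ge1$ (with $n^0=1$), and $L_N=\max_{0\le j\le N}S_j$. Define $$V^*=\frac{1}{\sigma\sqrt N}\ \inf_{\alpha\in[0,1],\,\kappa\in\mathbb{R}}\Bigl(c\,\sigma\kappa N^{\alpha}+p\,\mathbf{E}[L_N]\Bigr),$$ $$V^{\ell}=\min_{y\in\mathbb{R}}\bigl(cy+pG(y)\bigr),\qquad V^{u}=\min_{\kappa\ge0}\left\{c\kappa+p\left(\frac1\kappa\Bigl[\tfrac12-\bar\Phi(\kappa)\Bigr]+G(\kappa)\right)\right\}.$$ Let $\kappa_\ell=\bar\Phi^{-1}(c/p)$ be the minimizer of the problem defining $V^\ell$ (so $V^\ell=p\,\phi(\kappa_\ell)$), and let $\kappa_u\ge0$ be the minimizer of the problem defining $V^u$, which solves the optimality equation $$c\kappa+pG(\kappa)=\frac p\kappa\Bigl(\tfrac12-\bar\Phi(\kappa)\Bigr).$$ Then $\kappa_\ell\le\kappa_u$ and $$\frac{V^u}{V^\ell}=\frac{2[c\kappa_u+pG(\kappa_u)]}{c\kappa_\ell+pG(\kappa_\ell)}=\frac{2[\frac12-\bar\Phi(\kappa_u)]}{\kappa_u\,\phi(\kappa_\ell)} .$$ Consequently, $$2\le\frac{V^u}{V^\ell}\le\frac{2\phi(0)}{\phi(\kappa_\ell)}\qquad\text{and}\qquad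 \frac{V^\ell}{V^u}\le\frac{V^\ell}{V^*}\le\frac{V^u}{V^*}\le\frac{V^u}{V^\ell}.$$
   Context: $\phi$ and $\Phi$ are the standard normal density and distribution functions, $\bar\Phi:=1-\Phi$, and $G(x):=\mathbf{E}[(Z-x)^+]=\phi(x)-x\bar\Phi(x)$ for $Z$ standard normal. At $\kappa=0$ the expression $\frac1\kappa[\frac12-\bar\Phi(\kappa)]$ is interpreted as its limit $\phi(0)$. Here $c$ is the per-unit production cost, $p$ the per-unit lost-sales penalty, and $L_N$ the cumulative lost sales. *)

theory Defs
  imports "HOL-Probability.Probability"
begin

definition Phibar :: "real \<Rightarrow> real" where
  "Phibar x = 1 - cdf std_normal_distribution x"

definition G :: "real \<Rightarrow> real" where
  "G x = (LINT z|std_normal_distribution. max 0 (z - x))"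

text \<open>The quotient \<open>(1/k) (1/2 - Phibar k)\<close>, extended to \<open>k = 0\<close> by its limit.\<close>

definition Phibar_quot :: "real \<Rightarrow> real" where
  "Phibar_quot k =
     (if k = 0 then std_normal_density 0 else (1 / k) * (1 / 2 - Phibar k))"

definition lower_cost :: "real \<Rightarrow> real \<Rightarrow> real \<Rightarrow> real" where
  "lower_cost c p y = c * y + p * G y"

definition upper_cost :: "real \<Rightarrow> real \<Rightarrow> real \<Rightarrow> real" where
  "upper_cost c p k = c * k + p * (Phibar_quot k + G k)"

text \<open>Infima in the conditionally complete lattice of the reals; that \<open>V_lower\<close> and
  \<open>V_upper\<close> are attained, hence minima, is part of the theorem.\<close>

definition V_lower :: "real \<Rightarrow> real \<Rightarrow> real" where
  "V_lower c p = (INF y. lower_cost c p y)"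

definition V_upper :: "real \<Rightarrow> real \<Rightarrow> real" where
  "V_upper c p = (INF k\<in>{0..}. upper_cost c p k)"

definition kappa_lower :: "real \<Rightarrow> real \<Rightarrow> real" where
  "kappa_lower c p = inv Phibar (c / p)"

definition kappa_upper :: "real \<Rightarrow> real \<Rightarrow> real" where
  "kappa_upper c p = arg_min (upper_cost c p) (\<lambda>k. 0 \<le> k)"

text \<open>The innovations \<open>Z\<close> are indexed from 1; \<open>Z 0\<close> is never used.\<close>

definition walk ::
  "(nat \<Rightarrow> 'a \<Rightarrow> real) \<Rightarrow> real \<Rightarrow> real \<Rightarrow> real \<Rightarrow> nat \<Rightarrow> 'a \<Rightarrow> real" where
  "walk Z \<sigma> \<alpha> \<kappa> n \<omega> =
     (if n = 0 then 0 else \<sigma> * (\<Sum>i=1..n. Z i \<omega>) - \<kappa> * \<sigma> * real n powr \<alpha>)"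

definition lost_sales ::
  "(nat \<Rightarrow> 'a \<Rightarrow> real) \<Rightarrow> real \<Rightarrow> real \<Rightarrow> real \<Rightarrow> nat \<Rightarrow> 'a \<Rightarrow> real" where
  "lost_sales Z \<sigma> \<alpha> \<kappa> N \<omega> = Max ((\<lambda>j. walk Z \<sigma> \<alpha> \<kappa> j \<omega>) ` {0..N})"

definition V_star ::
  "'a measure \<Rightarrow> (nat \<Rightarrow> 'a \<Rightarrow> real) \<Rightarrow> real \<Rightarrow> real \<Rightarrow> real \<Rightarrow> nat \<Rightarrow> real" where
  "V_star M Z \<sigma> c p N =
     1 / (\<sigma> * sqrt (real N)) *
     (INF (\<alpha>, \<kappa>) \<in> {0..1} \<times> UNIV.
        c * \<sigma> * \<kappa> * real N powr \<alpha> + p * (LINT \<omega>|M. lost_sales Z \<sigma> \<alpha> \<kappa> N \<omega>))"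

end

theory Submission
  imports Defs "HOL-Real_Asymp.Real_Asymp"
begin

text \<open>
  The two bounds sandwich \<open>V_star\<close>, and the rest is calculus with \<open>G\<close>.

  \<^emph>\<open>Lower bound.\<close> The maximum of the walk is at least \<open>max 0 S\<^sub>N\<close>, and \<open>S\<^sub>N\<close> is Gaussian, so for
  every \<open>\<alpha>\<close> and \<open>\<kappa>\<close> the normalised cost is at least \<open>c y + p G y\<close> with
  \<open>y = \<kappa> N powr (\<alpha> - 1/2)\<close> (\<open>expected_lost_sales_ge\<close>). Since \<open>G' = - Phibar\<close>, this function of \<open>y\<close>
  has derivative \<open>c - p Phibar y\<close>; it is minimal exactly where \<open>Phibar y = c / p\<close>, with value
  \<open>p \<phi> y\<close> because \<open>G y = \<phi> y - y Phibar y\<close>.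

  \<^emph>\<open>Upper bound.\<close> Take \<open>\<alpha> = 1\<close> and \<open>\<kappa> = k / sqrt N\<close>, so that the walk has i.i.d. increments. Spitzer's
  identity (\<open>spitzer_expected_max\<close>) turns the expected maximum into the sum of \<open>E[max 0 S\<^sub>n] / n\<close>,
  here \<open>\<sigma>\<close> times the sum of \<open>G (\<mu> sqrt n) / sqrt n\<close> with \<open>\<mu> = k / sqrt N\<close>. As \<open>G\<close> decreases,
  this is at most the integral of \<open>G (\<mu> sqrt t) / sqrt t\<close> over \<open>[0, N]\<close>, which equals \<open>sqrt N\<close> times
  \<open>Phibar_quot k + G k\<close> (\<open>sum_G_sqrt_le\<close>).

  \<^emph>\<open>The minimiser of the upper cost.\<close> The derivative of \<open>Phibar_quot + G\<close> is \<open>- loss_slope\<close>, where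
  \<open>loss_slope k = (Phibar_quot k - G k) / k\<close> is the mean of \<open>2 s Phibar (k s)\<close> over \<open>s\<close> in \<open>[0, 1]\<close>. It
  decreases strictly from \<open>1/2\<close> to \<open>0\<close> and lies above \<open>Phibar\<close>. Hence \<open>upper_cost\<close> is minimal at
  the root of \<open>loss_slope k = c / p\<close>, or at \<open>0\<close> if \<open>c / p\<close> is at least \<open>1/2\<close>. Either way the
  first-order condition reads \<open>c k + p G k = p Phibar_quot k\<close>, trivially so at \<open>0\<close>, and
  \<open>Phibar k \<le> c / p\<close> puts the minimiser to the right of that of the lower cost. The
  first-order condition doubles the lower cost at this point, so \<open>V_upper\<close> is twice \<open>lower_cost\<close> there,
  which is at least \<open>2 V_lower\<close>; the other bound on the ratio is \<open>Phibar_quot k \<le> \<phi> 0\<close>.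
\<close>

section \<open>Spitzer's identity for the expected maximum\<close>

definition running_max :: "nat \<Rightarrow> (nat \<Rightarrow> real) \<Rightarrow> real" where
  "running_max n x = Max ((\<lambda>j. \<Sum>i=1..j. x i) ` {0..n})"

lemma running_max_Suc:
  "running_max (Suc n) x = max (running_max n x) (\<Sum>i=1..Suc n. x i)"
proof -
  have "{0..Suc n} = insert (Suc n) {0..n}" by auto
  then show ?thesis
    unfolding running_max_def by (simp add: max.commute)
qed

lemma running_max_nonneg: "0 \<le> running_max n x"
  by (induction n) (auto simp: running_max_Suc, simp add: running_max_def)

lemma running_max_cong:
  assumes "\<And>i. 1 \<le> i \<Longrightarrow> i \<le> n \<Longrightarrow> x i = y i"
  shows "running_max n x = running_max n y"
  unfolding running_max_def using assms
  by (intro arg_cong[where f = Max] image_cong sum.cong) auto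

lemma running_max_first_step:
  "running_max (Suc n) x = max 0 (x 1 + running_max n (\<lambda>i. x (Suc i)))"
proof (induction n)
  case 0
  show ?case by (simp add: running_max_Suc) (simp add: running_max_def)
next
  case (Suc n)
  have "(\<Sum>i=1..Suc (Suc n). x i) = x 1 + (\<Sum>i=1..Suc n. x (Suc i))"
    by (simp add: sum.atLeast_Suc_atMost sum.shift_bounds_cl_Suc_ivl del: sum.cl_ivl_Suc)
  then show ?case
    using Suc running_max_Suc[of "Suc n" x] running_max_Suc[of n "\<lambda>i. x (Suc i)"]
    by (simp add: max_def del: sum.cl_ivl_Suc)
qed

text \<open>If the final sum is not positive, the maximum is already attained earlier. If it is positive, the
  maximum is not at time \<open>0\<close> and the first increment can be split off. Both cases compare the maximum
  over \<open>n + 1\<close> steps with maxima over \<open>n\<close> steps, on an event that is symmetric in the increments.\<close>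

lemma running_max_step:
  defines "S \<equiv> \<lambda>n x. \<Sum>i=1..n. x i :: real"
  shows "running_max (Suc n) x = running_max n x +
    (if S (Suc n) x > 0 then x 1 + running_max n (\<lambda>i. x (Suc i)) - running_max n x else 0)"
proof (cases "S (Suc n) x > 0")
  case True
  have "running_max (Suc n) x \<ge> S (Suc n) x"
    by (simp add: running_max_Suc S_def)
  with True show ?thesis
    using running_max_first_step[of n x] by (auto simp: max_def split: if_splits)
next
  case False
  then show ?thesis
    using running_max_nonneg[of n x] by (simp add: running_max_Suc S_def)
qed

text \<open>I.i.d. variables are exchangeable: their joint law is a power of one measure, and permuting
  coordinates preserves it.\<close>

lemma (in prob_space) iid_permuted_expectation:
  fixes X :: "'i \<Rightarrow> 'a \<Rightarrow> real" and f :: "('i \<Rightarrow> real) \<Rightarrow> real"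
  assumes "I \<noteq> {}"
    and indep: "indep_vars (\<lambda>_. borel) X I"
    and ident: "\<And>i. i \<in> I \<Longrightarrow> distr M borel (X i) = D"
    and bij: "bij_betw \<pi> I I"
    and f[measurable]: "f \<in> borel_measurable (Pi\<^sub>M I (\<lambda>_. borel))"
  shows "expectation (\<lambda>\<omega>. f (\<lambda>i\<in>I. X (\<pi> i) \<omega>)) = expectation (\<lambda>\<omega>. f (\<lambda>i\<in>I. X i \<omega>))"
proof -
  have rv[measurable]: "random_variable borel (X i)" if "i \<in> I" for i
    using indep that by (simp add: indep_vars_def)
  have \<pi>: "\<pi> i \<in> I" if "i \<in> I" for i
    using bij that by (auto simp: bij_betw_def)
  let ?B = "Pi\<^sub>M I (\<lambda>_. borel :: real measure)"
  let ?P = "Pi\<^sub>M I (\<lambda>_. D)"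
  obtain i0 where "i0 \<in> I" using \<open>I \<noteq> {}\<close> by auto
  then have D: "prob_space D" "sets D = sets borel"
    using ident[of i0] prob_space_distr[OF rv] by auto
  have sets: "sets ?P = sets ?B"
    by (intro sets_PiM_cong) (auto simp: D)
  have law: "distr M ?B (\<lambda>\<omega>. \<lambda>i\<in>I. X i \<omega>) = ?P"
    using indep_vars_iff_distr_eq_PiM'[OF \<open>I \<noteq> {}\<close>, of X "\<lambda>_. borel"] rv indep
    by (auto simp: ident cong: PiM_cong)
  have inv: "distr ?P ?P (\<lambda>x. \<lambda>i\<in>I. x (\<pi> i)) = ?P"
    using distr_PiM_reindex[of I "\<lambda>_. D" \<pi> I] D bij by (auto simp: bij_betw_def)
  have shuffle: "(\<lambda>x. \<lambda>i\<in>I. x (\<pi> i)) \<in> measurable ?B ?B"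
    using \<pi> by measurable
  have [measurable]: "(\<lambda>\<omega>. \<lambda>i\<in>I. X i \<omega>) \<in> measurable M ?B"
    by measurable
  have "expectation (\<lambda>\<omega>. f (\<lambda>i\<in>I. X (\<pi> i) \<omega>)) =
        expectation (\<lambda>\<omega>. f ((\<lambda>x. \<lambda>i\<in>I. x (\<pi> i)) (\<lambda>i\<in>I. X i \<omega>)))"
    using \<pi> by (intro Bochner_Integration.integral_cong arg_cong[where f = f]) auto
  also have "\<dots> = (LINT x|?P. f (\<lambda>i\<in>I. x (\<pi> i)))"
    unfolding law[symmetric] using shuffle f
    by (subst integral_distr) (auto intro: measurable_compose)
  also have "\<dots> = (LINT x|?P. f x)"
    by (subst (2) inv[symmetric], subst integral_distr)
      (use shuffle f in \<open>auto simp: sets cong: measurable_cong_sets\<close>)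
  also have "\<dots> = expectation (\<lambda>\<omega>. f (\<lambda>i\<in>I. X i \<omega>))"
    unfolding law[symmetric] by (subst integral_distr) auto
  finally show ?thesis .
qed

lemma running_max_measurable:
  assumes "{1..n} \<subseteq> I"
  shows "running_max n \<in> borel_measurable (Pi\<^sub>M I (\<lambda>_. borel))"
proof -
  have *: "(\<lambda>x. x i) \<in> borel_measurable (Pi\<^sub>M I (\<lambda>_. borel :: real measure))"
    if "1 \<le> i" "i \<le> n" for i
    using that assms by (intro measurable_component_singleton) auto
  show ?thesis
    unfolding running_max_def by (intro borel_measurable_Max borel_measurable_sum) (auto intro: *)
qed

lemma integrable_Max:
  fixes f :: "'i \<Rightarrow> 'a \<Rightarrow> real"
  assumes "finite I" "I \<noteq> {}" "\<And>i. i \<in> I \<Longrightarrow> integrable M (f i)"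
  shows "integrable M (\<lambda>x. Max ((\<lambda>i. f i x) ` I))"
  using assms
  by (induction I rule: finite_ne_induct) (auto intro!: Bochner_Integration.integrable_max)

lemma running_max_integrable:
  assumes "\<And>i. 1 \<le> i \<Longrightarrow> i \<le> n \<Longrightarrow> integrable M (X i)"
  shows "integrable M (\<lambda>\<omega>. running_max n (\<lambda>i. X i \<omega>))"
  unfolding running_max_def using assms
  by (intro integrable_Max Bochner_Integration.integrable_sum) auto

text \<open>Swapping the increments \<open>1\<close> and \<open>k\<close> leaves the sum, hence the event, unchanged.\<close>

lemma (in prob_space) iid_expectation_on_positive_sum:
  fixes X :: "nat \<Rightarrow> 'a \<Rightarrow> real"
  assumes "1 \<le> n" and k: "1 \<le> k" "k \<le> n"
    and indep: "indep_vars (\<lambda>_. borel) X {1..n}"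
    and ident: "\<And>i. i \<in> {1..n} \<Longrightarrow> distr M borel (X i) = D"
  shows "expectation (\<lambda>\<omega>. if (\<Sum>i=1..n. X i \<omega>) > 0 then X k \<omega> else 0) =
    expectation (\<lambda>\<omega>. if (\<Sum>i=1..n. X i \<omega>) > 0 then X 1 \<omega> else 0)"
proof -
  let ?f = "\<lambda>x. if (\<Sum>i=1..n. x i) > (0::real) then x 1 else (0::real)"
  let ?\<pi> = "Transposition.transpose 1 k"
  have perm: "?\<pi> permutes {1..n}"
    using k by (intro permutes_swap_id) auto
  have [measurable]: "(\<lambda>x. x i) \<in> borel_measurable (Pi\<^sub>M {1..n} (\<lambda>_. borel :: real measure))"
    if "i \<in> {1..n}" for i
    using that by (intro measurable_component_singleton) auto
  have [measurable]: "(\<lambda>x. x 1) \<in> borel_measurable (Pi\<^sub>M {1..n} (\<lambda>_. borel :: real measure))"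
    using k by (intro measurable_component_singleton) auto
  have *: "?f \<in> borel_measurable (Pi\<^sub>M {1..n} (\<lambda>_. borel))"
    by measurable
  have sum: "(\<Sum>i=1..n. X (?\<pi> i) \<omega>) = (\<Sum>i=1..n. X i \<omega>)" for \<omega>
    using sum.permute[OF perm, of "\<lambda>i. X i \<omega>"] by (simp add: o_def)
  have "expectation (\<lambda>\<omega>. ?f (\<lambda>i\<in>{1..n}. X (?\<pi> i) \<omega>)) = expectation (\<lambda>\<omega>. ?f (\<lambda>i\<in>{1..n}. X i \<omega>))"
    by (rule iid_permuted_expectation[OF _ indep ident permutes_imp_bij[OF perm] *]) (use k in auto)
  then show ?thesis
    using k by (simp add: sum del: One_nat_def cong: if_cong)
qed

text \<open>Take expectations in \<open>running_max_step\<close>. The event \<open>S\<^sub>n > 0\<close> is invariant under rotating the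
  increments, and a rotation carries the maximum over the first \<open>n - 1\<close> increments to the maximum
  over the last \<open>n - 1\<close>, so these two terms cancel. What remains is the expectation of the first
  increment on \<open>S\<^sub>n > 0\<close>, which by symmetry is \<open>E[max 0 S\<^sub>n] / n\<close>.\<close>

theorem (in prob_space) spitzer_expected_max:
  fixes X :: "nat \<Rightarrow> 'a \<Rightarrow> real"
  assumes indep: "indep_vars (\<lambda>_. borel) X {1..N}"
    and ident: "\<And>i. i \<in> {1..N} \<Longrightarrow> distr M borel (X i) = D"
    and int: "\<And>i. i \<in> {1..N} \<Longrightarrow> integrable M (X i)"
  shows "expectation (\<lambda>\<omega>. running_max N (\<lambda>i. X i \<omega>)) =
    (\<Sum>n=1..N. expectation (\<lambda>\<omega>. max 0 (\<Sum>i=1..n. X i \<omega>)) / n)"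
  using assms
proof (induction N)
  case 0
  then show ?case by (simp add: running_max_def)
next
  case (Suc N)
  let ?n = "Suc N"
  let ?S = "\<lambda>\<omega>. \<Sum>i=1..?n. X i \<omega>"
  let ?on = "\<lambda>f \<omega>. if ?S \<omega> > 0 then f \<omega> else (0::real)"
  let ?Y = "\<lambda>\<omega>. running_max N (\<lambda>i. X i \<omega>)"
  let ?Y' = "\<lambda>\<omega>. running_max N (\<lambda>i. X (Suc i) \<omega>)"
  have [measurable]: "random_variable borel (X i)" if "i \<in> {1..?n}" for i
    using Suc.prems(3)[OF that] by auto
  have S_meas[measurable]: "random_variable borel ?S"
    by measurable
  have on: "integrable M (?on f)" if "integrable M f" for f
    by (rule Bochner_Integration.integrable_bound[OF that])
      (use borel_measurable_integrable[OF that] S_meas in \<open>auto intro!: measurable_If\<close>)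
  have iX: "integrable M (X i)" if "1 \<le> i" "i \<le> ?n" for i
    using Suc.prems(3) that by auto
  have iY: "integrable M ?Y" "integrable M ?Y'"
    using iX by (auto intro!: running_max_integrable)
  \<comment> \<open>the rotation of the increments\<close>
  let ?\<pi> = "\<lambda>i. if i = ?n then 1 else Suc i"
  have bij: "bij_betw ?\<pi> {1..?n} {1..?n}"
    by (rule bij_betwI[where g = "\<lambda>i. if i = 1 then ?n else i - 1"]) auto
  have cyc: "(\<Sum>i=1..?n. X (?\<pi> i) \<omega>) = ?S \<omega>" for \<omega>
    using sum.reindex_bij_betw[OF bij, of "\<lambda>i. X i \<omega>"] by simp
  let ?f = "\<lambda>x. if (\<Sum>i=1..?n. x i) > (0::real) then running_max N x else (0::real)"
  have [measurable]: "(\<lambda>x. x i) \<in> borel_measurable (Pi\<^sub>M {1..?n} (\<lambda>_. borel :: real measure))"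
    if "i \<in> {1..?n}" for i
    using that by (intro measurable_component_singleton) auto
  have [measurable]: "running_max N \<in> borel_measurable (Pi\<^sub>M {1..?n} (\<lambda>_. borel))"
    by (rule running_max_measurable) auto
  have f_meas: "?f \<in> borel_measurable (Pi\<^sub>M {1..?n} (\<lambda>_. borel))"
    by measurable
  have shift: "expectation (?on ?Y') = expectation (?on ?Y)"
  proof -
    have "expectation (\<lambda>\<omega>. ?f (\<lambda>i\<in>{1..?n}. X (?\<pi> i) \<omega>)) =
      expectation (\<lambda>\<omega>. ?f (\<lambda>i\<in>{1..?n}. X i \<omega>))"
      by (rule iid_permuted_expectation[OF _ Suc.prems(1,2) bij f_meas]) auto
    moreover have "?f (\<lambda>i\<in>{1..?n}. X (?\<pi> i) \<omega>) = ?on ?Y' \<omega>" for \<omega>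
    proof -
      have "(\<Sum>i=1..?n. (\<lambda>i\<in>{1..?n}. X (?\<pi> i) \<omega>) i) = ?S \<omega>"
        unfolding cyc[symmetric] by (intro sum.cong) auto
      moreover have "running_max N (\<lambda>i\<in>{1..?n}. X (?\<pi> i) \<omega>) = ?Y' \<omega>"
        by (rule running_max_cong) auto
      ultimately show ?thesis by (simp only:)
    qed
    moreover have "?f (\<lambda>i\<in>{1..?n}. X i \<omega>) = ?on ?Y \<omega>" for \<omega>
    proof -
      have "(\<Sum>i=1..?n. (\<lambda>i\<in>{1..?n}. X i \<omega>) i) = ?S \<omega>"
        by (intro sum.cong) auto
      moreover have "running_max N (\<lambda>i\<in>{1..?n}. X i \<omega>) = ?Y \<omega>"
        by (rule running_max_cong) auto
      ultimately show ?thesis by (simp only:)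
    qed
    ultimately show ?thesis by simp
  qed
  have first: "?n * expectation (?on (X 1)) = expectation (\<lambda>\<omega>. max 0 (?S \<omega>))"
  proof -
    have "expectation (\<lambda>\<omega>. max 0 (?S \<omega>)) = expectation (\<lambda>\<omega>. \<Sum>k=1..?n. ?on (X k) \<omega>)"
    proof (rule Bochner_Integration.integral_cong[OF refl])
      have "max 0 s = (\<Sum>k\<in>A. if s > 0 then g k else 0)" if "s = sum g A"
        for s :: real and g and A :: "nat set"
        using that by (cases "s > 0") auto
      then show "max 0 (?S \<omega>) = (\<Sum>k=1..?n. ?on (X k) \<omega>)" for \<omega>
        by blast
    qed
    also have "\<dots> = (\<Sum>k=1..?n. expectation (?on (X k)))"
      by (intro Bochner_Integration.integral_sum on iX) auto
    also have "\<dots> = (\<Sum>k=1..?n. expectation (?on (X 1)))"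
    proof (rule sum.cong[OF refl])
      fix k assume "k \<in> {1..?n}"
      then have k: "1 \<le> ?n" "1 \<le> k" "k \<le> ?n" by auto
      show "expectation (?on (X k)) = expectation (?on (X 1))"
        by (rule iid_expectation_on_positive_sum[OF k Suc.prems(1,2)])
    qed
    finally show ?thesis by simp
  qed
  have "expectation (\<lambda>\<omega>. running_max ?n (\<lambda>i. X i \<omega>)) =
    expectation (\<lambda>\<omega>. ?Y \<omega> + (?on (X 1) \<omega> + ?on ?Y' \<omega> - ?on ?Y \<omega>))"
    by (intro Bochner_Integration.integral_cong) (auto simp: running_max_step simp del: sum.cl_ivl_Suc)
  also have "\<dots> = expectation ?Y + (expectation (?on (X 1)) + expectation (?on ?Y') - expectation (?on ?Y))"
    using on[OF iY(1)] on[OF iY(2)] on[OF iX[of 1]] iY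
    by (simp del: sum.cl_ivl_Suc)
  also have "\<dots> = expectation ?Y + expectation (?on (X 1))"
    using shift by simp
  also have "expectation (?on (X 1)) = expectation (\<lambda>\<omega>. max 0 (?S \<omega>)) / ?n"
    using first by (simp add: field_simps del: sum.cl_ivl_Suc)
  also have "expectation ?Y = (\<Sum>n=1..N. expectation (\<lambda>\<omega>. max 0 (\<Sum>i=1..n. X i \<omega>)) / n)"
    by (rule Suc.IH) (use Suc.prems in \<open>auto intro: indep_vars_subset\<close>)
  finally show ?case by simp
qed

section \<open>The normal tail and the loss function\<close>

abbreviation (input) \<phi> :: "real \<Rightarrow> real" where "\<phi> \<equiv> std_normal_density"

lemma std_normal_density_has_derivative:
  "(\<phi> has_real_derivative - x * \<phi> x) (at x)"
  unfolding std_normal_density_def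
  by (auto intro!: derivative_eq_intros simp: field_simps power2_eq_square)

lemma std_normal_density_le_at_0: "\<phi> x \<le> \<phi> 0"
  by (simp add: std_normal_density_def field_simps)

lemma std_normal_density_tendsto_0: "(\<phi> \<longlongrightarrow> 0) at_top"
  unfolding std_normal_density_def by real_asymp

interpretation std_normal: real_distribution std_normal_distribution
  by (rule real_dist_normal_dist)

lemma Phibar_diff:
  assumes "a \<le> b"
  shows "Phibar b = Phibar a - integral {a..b} \<phi>"
proof (cases "a = b")
  case False
  have "cdf std_normal_distribution b - cdf std_normal_distribution a =
    measure std_normal_distribution {a<..b}"
    using assms False by (intro std_normal.cdf_diff_eq) auto
  also have "\<dots> = (LINT x|std_normal_distribution. indicator {a<..b} x)"
    by simp
  also have "\<dots> = (LINT x|lborel. \<phi> x * indicator {a<..b} x)"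
    by (subst integral_density) auto
  also have "\<dots> = (LINT x|lborel. \<phi> x * indicator {a..b} x)"
  proof (rule integral_cong_AE)
    show "AE x in lborel. \<phi> x * indicator {a<..b} x = \<phi> x * indicator {a..b} x"
      using AE_lborel_singleton[of a] by eventually_elim (auto simp: indicator_def)
  qed auto
  also have "\<dots> = (LINT x:{a..b}|lborel. \<phi> x)"
    by (simp add: set_lebesgue_integral_def mult.commute)
  also have "\<dots> = integral {a..b} \<phi>"
    by (rule set_borel_integral_eq_integral, unfold set_integrable_def,
        rule integrable_mult_indicator) auto
  finally show ?thesis by (simp add: Phibar_def)
qed simp

lemma Phibar_has_derivative: "(Phibar has_real_derivative - \<phi> x) (at x)"
proof -
  have "((\<lambda>u. integral {x - 1..u} \<phi>) has_real_derivative \<phi> x) (at x within {x - 1..x + 1})"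
    by (intro integral_has_real_derivative continuous_at_imp_continuous_on ballI
        DERIV_isCont[OF std_normal_density_has_derivative]) auto
  then have "((\<lambda>u. Phibar (x - 1) - integral {x - 1..u} \<phi>) has_real_derivative - \<phi> x)
    (at x within {x - 1..x + 1})"
    by (auto intro!: derivative_eq_intros)
  then have "((\<lambda>u. Phibar (x - 1) - integral {x - 1..u} \<phi>) has_real_derivative - \<phi> x) (at x)"
    by (subst (asm) at_within_Icc_at) auto
  moreover have "\<forall>\<^sub>F u in nhds x. Phibar (x - 1) - integral {x - 1..u} \<phi> = Phibar u"
    by (rule eventually_nhds_in_open[of "{x - 1<..}" x, THEN eventually_mono])
      (auto simp: Phibar_diff[of "x - 1", symmetric])
  ultimately show ?thesis
    by (rule DERIV_cong_ev[OF refl _ refl, THEN iffD1, rotated])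
qed

lemma Phibar_isCont: "isCont Phibar x"
  by (rule DERIV_isCont[OF Phibar_has_derivative])

lemma Phibar_strict_antimono: "x < y \<Longrightarrow> Phibar y < Phibar x"
  by (rule DERIV_neg_imp_decreasing) (use Phibar_has_derivative normal_density_pos[of 1 0] in force)+

lemma Phibar_tendsto_at_top: "(Phibar \<longlongrightarrow> 0) at_top"
  unfolding Phibar_def[abs_def]
  using tendsto_diff[OF tendsto_const[of 1] std_normal.cdf_lim_at_top_prob] by simp

lemma Phibar_tendsto_at_bot: "(Phibar \<longlongrightarrow> 1) at_bot"
  unfolding Phibar_def[abs_def]
  using tendsto_diff[OF tendsto_const[of 1] std_normal.cdf_lim_at_bot] by simp

lemma Phibar_nonneg: "0 \<le> Phibar x"
  using std_normal.cdf_bounded_prob by (simp add: Phibar_def)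

text \<open>The sum \<open>Phibar x + Phibar (- x)\<close> has derivative zero because the density is even, and it tends to
  \<open>1\<close> at infinity.\<close>

lemma Phibar_0: "Phibar 0 = 1 / 2"
proof -
  have "((\<lambda>x. Phibar x + Phibar (- x)) has_real_derivative 0) (at x)" for x
    using DERIV_add[OF Phibar_has_derivative[of x]
        DERIV_chain2[OF Phibar_has_derivative[of "- x"] DERIV_minus[OF DERIV_ident]]]
    by (simp add: std_normal_density_def)
  then have "Phibar x + Phibar (- x) = Phibar 0 + Phibar (- 0)" for x
    using DERIV_isconst_all[of "\<lambda>x. Phibar x + Phibar (- x)" x 0] by simp
  then have const: "(\<lambda>x. Phibar x + Phibar (- x)) = (\<lambda>_. 2 * Phibar 0)"
    by (intro ext) simp
  have "((\<lambda>x. Phibar x + Phibar (- x)) \<longlongrightarrow> 0 + 1) at_top"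
    by (intro tendsto_add Phibar_tendsto_at_top
        filterlim_compose[OF Phibar_tendsto_at_bot filterlim_uminus_at_bot_at_top])
  then have "2 * Phibar 0 = 1"
    unfolding const by (simp add: tendsto_const_iff)
  then show ?thesis by simp
qed

lemma Phibar_surj_unit_interval:
  assumes "0 < q" "q < 1"
  obtains x where "Phibar x = q"
proof -
  obtain a where a: "Phibar a > q"
    using eventually_happens[OF order_tendstoD(1)[OF Phibar_tendsto_at_bot assms(2)]] by auto
  obtain b where b: "Phibar b < q"
    using eventually_happens[OF order_tendstoD(2)[OF Phibar_tendsto_at_top assms(1)]] by auto
  have "a \<le> b"
    using a b Phibar_strict_antimono[of b a] by (cases "a \<le> b") auto
  then obtain x where "Phibar x = q"
    using IVT2[of Phibar b q a] a b Phibar_isCont by (meson less_imp_le)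
  then show ?thesis by (rule that)
qed

text \<open>The function \<open>z \<mapsto> x * Phibar z - \<phi> z\<close> is an antiderivative of \<open>(z - x) * \<phi> z\<close> that vanishes at
  infinity, so the defining integral is evaluated by the fundamental theorem of calculus.\<close>

lemma G_eq: "G x = \<phi> x - x * Phibar x"
proof -
  define F where "F z = - \<phi> z + x * Phibar z" for z
  have F: "(F has_real_derivative (z - x) * \<phi> z) (at z)" for z
    unfolding F_def
    by (auto intro!: derivative_eq_intros std_normal_density_has_derivative Phibar_has_derivative
        simp: algebra_simps)
  have lim: "(F \<longlongrightarrow> 0) at_top"
    unfolding F_def
    using tendsto_add[OF tendsto_minus[OF std_normal_density_tendsto_0]
        tendsto_mult[OF tendsto_const Phibar_tendsto_at_top, of x]] by simp
  have "G x = (LINT z|lborel. \<phi> z * max 0 (z - x))"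
    unfolding G_def by (subst integral_density) auto
  also have "\<dots> = enn2real (\<integral>\<^sup>+z. ennreal (\<phi> z * max 0 (z - x)) \<partial>lborel)"
    by (rule integral_eq_nn_integral) auto
  also have "(\<integral>\<^sup>+z. ennreal (\<phi> z * max 0 (z - x)) \<partial>lborel) =
    (\<integral>\<^sup>+z. ennreal ((z - x) * \<phi> z) * indicator {x..} z \<partial>lborel)"
    by (intro nn_integral_cong) (auto simp: indicator_def max_def)
  also have "\<dots> = ennreal (0 - F x)"
    by (rule nn_integral_FTC_atLeast[OF _ F _ lim]) auto
  finally have "G x = enn2real (ennreal (- F x))" by simp
  moreover have "F x \<le> 0"
  proof (rule tendsto_lowerbound[OF lim])
    have "F x \<le> F z" if "x \<le> z" for z
    proof (rule DERIV_nonneg_imp_nondecreasing[OF that, where f = F])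
      show "\<exists>y. (F has_real_derivative y) (at t) \<and> 0 \<le> y" if "x \<le> t" for t
        using F[of t] that by (intro exI[of _ "(t - x) * \<phi> t"]) simp
    qed
    then show "\<forall>\<^sub>F z in at_top. F x \<le> F z"
      by (rule eventually_mono[OF eventually_ge_at_top[of x]])
  qed simp
  ultimately show ?thesis by (simp add: F_def)
qed

lemma G_nonneg: "0 \<le> G x"
  unfolding G_def by (rule Bochner_Integration.integral_nonneg) auto

lemma G_has_derivative: "(G has_real_derivative - Phibar x) (at x)"
proof -
  have "((\<lambda>x. \<phi> x - x * Phibar x) has_real_derivative - Phibar x) (at x)"
    by (auto intro!: derivative_eq_intros std_normal_density_has_derivative Phibar_has_derivative
        simp: algebra_simps)
  then show ?thesis by (simp only: G_eq[abs_def])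
qed

lemma G_antimono: "x \<le> y \<Longrightarrow> G y \<le> G x"
  by (erule DERIV_nonpos_imp_nonincreasing[where f = G])
    (auto intro: exI[of _ "- Phibar _"] G_has_derivative simp: Phibar_nonneg)

section \<open>The lower cost\<close>

text \<open>The derivative is asked for in the interior only, so that the minimum may sit at the endpoint of a
  half-line, as it does for the upper cost when \<open>c / p \<ge> 1/2\<close>.\<close>

lemma strict_min_by_derivative_sign:
  fixes f :: "real \<Rightarrow> real"
  assumes S: "is_interval S" "m \<in> S" and cont: "continuous_on S f"
    and deriv: "\<And>x. x \<in> interior S \<Longrightarrow> (f has_real_derivative f' x) (at x)"
    and left: "\<And>x. x \<in> interior S \<Longrightarrow> x < m \<Longrightarrow> f' x < 0"
    and right: "\<And>x. x \<in> interior S \<Longrightarrow> m < x \<Longrightarrow> 0 < f' x"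
    and y: "y \<in> S" "y \<noteq> m"
  shows "f m < f y"
proof -
  have sub: "{a..b} \<subseteq> S" if "a \<in> S" "b \<in> S" for a b
    using mem_is_interval_1_I[OF S(1) that] by auto
  have int: "x \<in> interior S" if "a \<in> S" "b \<in> S" "a < x" "x < b" for a b x
    using subsetD[OF interior_mono[OF sub[OF that(1,2)]], of x] that(3,4)
    by (simp add: interior_atLeastAtMost_real)
  show ?thesis
  proof (cases "y < m")
    case True
    show ?thesis
    proof (rule DERIV_neg_imp_decreasing_open[OF True, where f = f])
      fix x assume x: "y < x" "x < m"
      note i = int[OF y(1) S(2) x]
      show "\<exists>d. (f has_real_derivative d) (at x) \<and> d < 0"
        using deriv[OF i] left[OF i x(2)] by (intro exI conjI)
    qed (rule continuous_on_subset[OF cont sub[OF y(1) S(2)]])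
  next
    case False
    then have "m < y" using y by simp
    then show ?thesis
    proof (rule DERIV_pos_imp_increasing_open[where f = f])
      fix x assume x: "m < x" "x < y"
      note i = int[OF S(2) y(1) x]
      show "\<exists>d. (f has_real_derivative d) (at x) \<and> 0 < d"
        using deriv[OF i] right[OF i x(1)] by (intro exI conjI)
    qed (rule continuous_on_subset[OF cont sub[OF S(2) y(1)]])
  qed
qed

lemma lower_cost_strict_min:
  assumes "0 < p" "Phibar m = c / p" "y \<noteq> m"
  shows "lower_cost c p m < lower_cost c p y"
proof -
  have c: "c = p * Phibar m" using assms by simp
  have deriv: "(lower_cost c p has_real_derivative c - p * Phibar x) (at x)" for x
    unfolding lower_cost_def by (auto intro!: derivative_eq_intros G_has_derivative)
  show ?thesis
  proof (rule strict_min_by_derivative_sign[where S = UNIV and f = "lower_cost c p" and m = m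
        and f' = "\<lambda>x. c - p * Phibar x"])
    show "continuous_on UNIV (lower_cost c p)"
      by (intro continuous_at_imp_continuous_on ballI DERIV_isCont[OF deriv])
    show "c - p * Phibar x < 0" if "x < m" for x
      using Phibar_strict_antimono[OF that] \<open>0 < p\<close> c by simp
    show "0 < c - p * Phibar x" if "m < x" for x
      using Phibar_strict_antimono[OF that] \<open>0 < p\<close> c by simp
  qed (use deriv assms in auto)
qed

section \<open>The upper cost\<close>

text \<open>For positive \<open>k\<close> this is the negative derivative of \<open>Phibar_quot + G\<close>, and also the mean of
  \<open>2 * s * Phibar (k * s)\<close> over \<open>s\<close> in \<open>[0, 1]\<close>. The second form explains why it decreases
  and lies between \<open>Phibar k\<close> and \<open>1/2\<close>.\<close>

definition loss_slope :: "real \<Rightarrow> real" where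
  "loss_slope k = (Phibar_quot k - G k) / k"

lemma loss_slope_eq:
  "k > 0 \<Longrightarrow> loss_slope k = (1 / 2 - Phibar k - k * \<phi> k) / k\<^sup>2 + Phibar k"
  by (simp add: loss_slope_def Phibar_quot_def G_eq field_simps power2_eq_square)

text \<open>The left-hand side is \<open>E[Z\<^sup>2; Z > k]\<close> for standard normal \<open>Z\<close>; its value at \<open>k = 0\<close> is \<open>1/2\<close> and it
  decreases with \<open>k\<close>. It governs both the sign of the derivative of \<open>loss_slope\<close> and the comparison
  of \<open>loss_slope\<close> with \<open>Phibar\<close>.\<close>

lemma second_moment_tail_less_half:
  assumes "0 < k"
  shows "Phibar k + k * \<phi> k < 1 / 2"
proof -
  have deriv: "((\<lambda>k. Phibar k + k * \<phi> k) has_real_derivative - (x\<^sup>2 * \<phi> x)) (at x)" for x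
    by (auto intro!: derivative_eq_intros std_normal_density_has_derivative Phibar_has_derivative
        simp: algebra_simps power2_eq_square)
  have "Phibar k + k * \<phi> k < Phibar 0 + 0 * \<phi> 0"
  proof (rule DERIV_neg_imp_decreasing_open[OF assms, where f = "\<lambda>k. Phibar k + k * \<phi> k"])
    show "\<exists>y. ((\<lambda>k. Phibar k + k * \<phi> k) has_real_derivative y) (at x) \<and> y < 0"
      if "0 < x" for x
      using deriv[of x] that normal_density_pos[of 1 0 x]
      by (intro exI[of _ "- (x\<^sup>2 * \<phi> x)"]) simp
    show "continuous_on {0..k} (\<lambda>k. Phibar k + k * \<phi> k)"
      by (intro continuous_at_imp_continuous_on ballI DERIV_isCont[OF deriv])
  qed
  then show ?thesis by (simp add: Phibar_0)
qed

lemma loss_slope_gt_Phibar: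
  assumes "0 < k"
  shows "Phibar k < loss_slope k"
  using second_moment_tail_less_half[OF assms] assms by (simp add: loss_slope_eq)

lemma loss_slope_has_derivative:
  assumes "0 < k"
  shows "(loss_slope has_real_derivative - (1 - 2 * Phibar k - 2 * k * \<phi> k) / k ^ 3) (at k)"
proof -
  have "((\<lambda>k. (1 / 2 - Phibar k - k * \<phi> k) / k\<^sup>2 + Phibar k) has_real_derivative
    - (1 - 2 * Phibar k - 2 * k * \<phi> k) / k ^ 3) (at k)"
    using assms
    by (auto intro!: derivative_eq_intros std_normal_density_has_derivative Phibar_has_derivative)
      (simp add: field_simps power2_eq_square power3_eq_cube power4_eq_xxxx)
  moreover have "\<forall>\<^sub>F x in nhds k. (1 / 2 - Phibar x - x * \<phi> x) / x\<^sup>2 + Phibar x = loss_slope x"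
    by (rule eventually_nhds_in_open[of "{0<..}" k, THEN eventually_mono])
      (use assms loss_slope_eq in auto)
  ultimately show ?thesis
    by (rule DERIV_cong_ev[OF refl _ refl, THEN iffD1, rotated])
qed

lemma loss_slope_isCont: "0 < k \<Longrightarrow> isCont loss_slope k"
  by (rule DERIV_isCont[OF loss_slope_has_derivative])

lemma loss_slope_strict_antimono:
  assumes "0 < a" "a < b"
  shows "loss_slope b < loss_slope a"
proof (rule DERIV_neg_imp_decreasing[OF \<open>a < b\<close>, where f = loss_slope])
  fix x assume "a \<le> x" "x \<le> b"
  then have "0 < x" using assms by simp
  then show "\<exists>y. (loss_slope has_real_derivative y) (at x) \<and> y < 0"
    using second_moment_tail_less_half[of x] loss_slope_has_derivative[of x]
    by (intro exI[of _ "- (1 - 2 * Phibar x - 2 * x * \<phi> x) / x ^ 3"])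
      (auto simp: divide_less_0_iff)
qed

text \<open>After multiplication by \<open>k\<^sup>2\<close>, the difference of the two sides vanishes at \<open>0\<close> and has derivative
  \<open>k * (2 * Phibar k - 1)\<close>, which is negative for positive \<open>k\<close>.\<close>

lemma loss_slope_less_half:
  assumes "0 < k"
  shows "loss_slope k < 1 / 2"
proof -
  let ?f = "\<lambda>k. 1 / 2 - Phibar k - k * \<phi> k + k\<^sup>2 * Phibar k - k\<^sup>2 / 2"
  have deriv: "(?f has_real_derivative x * (2 * Phibar x - 1)) (at x)" for x
    by (auto intro!: derivative_eq_intros std_normal_density_has_derivative Phibar_has_derivative
        simp: algebra_simps power2_eq_square)
  have "?f k < ?f 0"
  proof (rule DERIV_neg_imp_decreasing_open[OF assms, where f = ?f])
    show "\<exists>y. (?f has_real_derivative y) (at x) \<and> y < 0" if "0 < x" for x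
      using deriv[of x] that Phibar_strict_antimono[OF that]
      by (intro exI[of _ "x * (2 * Phibar x - 1)"]) (simp add: Phibar_0 mult_less_0_iff)
    show "continuous_on {0..k} ?f"
      by (intro continuous_at_imp_continuous_on ballI DERIV_isCont[OF deriv])
  qed
  then show ?thesis using assms by (simp add: Phibar_0 loss_slope_eq field_simps)
qed

lemma loss_slope_tendsto_0: "(loss_slope \<longlongrightarrow> 0) at_top"
proof (rule tendsto_sandwich)
  show "\<forall>\<^sub>F k in at_top. 0 \<le> loss_slope k"
    using eventually_gt_at_top[of 0]
  proof eventually_elim
    case (elim k)
    then show ?case using loss_slope_gt_Phibar[of k] Phibar_nonneg[of k] by simp
  qed
  show "\<forall>\<^sub>F k in at_top. loss_slope k \<le> 1 / k\<^sup>2 + Phibar k"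
    using eventually_gt_at_top[of 0]
  proof eventually_elim
    case (elim k)
    have "0 \<le> k * \<phi> k" using elim by simp
    then have "1 / 2 - Phibar k - k * \<phi> k \<le> 1"
      using Phibar_nonneg[of k] by linarith
    then show ?case
      using elim by (simp add: loss_slope_eq divide_right_mono)
  qed
  have "((\<lambda>k::real. 1 / k\<^sup>2) \<longlongrightarrow> 0) at_top" by real_asymp
  from tendsto_add[OF this Phibar_tendsto_at_top]
  show "((\<lambda>k. 1 / k\<^sup>2 + Phibar k) \<longlongrightarrow> 0) at_top" by simp
qed simp

text \<open>Intermediate values between the point where \<open>Phibar\<close> equals \<open>q\<close>, at which \<open>loss_slope\<close> is still
  larger than \<open>q\<close>, and a point far out.\<close>

lemma loss_slope_surj_lower_half:
  assumes "0 < q" "q < 1 / 2"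
  obtains k where "0 < k" "loss_slope k = q"
proof -
  obtain b where b: "0 < b" "loss_slope b < q"
    using eventually_happens[OF eventually_conj[OF eventually_gt_at_top[of 0]
      order_tendstoD(2)[OF loss_slope_tendsto_0 assms(1)]]] by auto
  obtain a where a: "Phibar a = q"
    using Phibar_surj_unit_interval[of q] assms by auto
  have "0 < a"
  proof (rule ccontr)
    assume "\<not> 0 < a"
    then show False
      using a assms(2) Phibar_strict_antimono[of a 0] by (cases "a = 0") (auto simp: Phibar_0)
  qed
  have "q < loss_slope a"
    using loss_slope_gt_Phibar[OF \<open>0 < a\<close>] a by simp
  then have "a \<le> b"
    using b loss_slope_strict_antimono[of b a] by (cases "a \<le> b") auto
  then obtain k where "a \<le> k" "loss_slope k = q"
    using IVT2[of loss_slope b q a] b \<open>q < loss_slope a\<close> \<open>0 < a\<close> loss_slope_isCont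
    by (meson less_imp_le less_le_trans)
  then show ?thesis using \<open>0 < a\<close> by (intro that[of k]) auto
qed

lemma Phibar_quot_has_derivative:
  assumes "0 < k"
  shows "(Phibar_quot has_real_derivative (\<phi> k - Phibar_quot k) / k) (at k)"
proof -
  have "((\<lambda>k. 1 / k * (1 / 2 - Phibar k)) has_real_derivative (\<phi> k - Phibar_quot k) / k) (at k)"
    using assms
    by (auto intro!: derivative_eq_intros Phibar_has_derivative)
      (simp add: Phibar_quot_def field_simps power2_eq_square)
  moreover have "\<forall>\<^sub>F x in nhds k. 1 / x * (1 / 2 - Phibar x) = Phibar_quot x"
    by (rule eventually_nhds_in_open[of "{0<..}" k, THEN eventually_mono])
      (use assms in \<open>auto simp: Phibar_quot_def\<close>)
  ultimately show ?thesis
    by (rule DERIV_cong_ev[OF refl _ refl, THEN iffD1, rotated])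
qed

text \<open>Up to sign, \<open>Phibar_quot\<close> is the difference quotient of \<open>Phibar\<close> at \<open>0\<close>.\<close>

lemma Phibar_quot_isCont_0: "isCont Phibar_quot 0"
proof -
  have "((\<lambda>k. 1 / k * (1 / 2 - Phibar k)) \<longlongrightarrow> \<phi> 0) (at 0)"
    using tendsto_minus[OF Phibar_has_derivative[of 0, unfolded DERIV_def]]
    by (simp add: Phibar_0 minus_divide_left)
  then have "(Phibar_quot \<longlongrightarrow> \<phi> 0) (at 0)"
    by (rule Lim_transform_eventually)
      (auto simp: Phibar_quot_def eventually_at_filter)
  then show ?thesis by (simp add: isCont_def Phibar_quot_def)
qed

lemma Phibar_quot_le:
  assumes "0 \<le> k"
  shows "Phibar_quot k \<le> \<phi> 0"
proof (cases "k = 0")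
  case False
  have "integral {0..k} \<phi> \<le> integral {0..k} (\<lambda>_. \<phi> 0)"
    by (intro integral_le integrable_continuous_interval continuous_at_imp_continuous_on ballI
        DERIV_isCont[OF std_normal_density_has_derivative] std_normal_density_le_at_0
        continuous_on_const)
  then have "1 / 2 - Phibar k \<le> k * \<phi> 0"
    using Phibar_diff[OF assms] assms by (simp add: Phibar_0)
  with False assms show ?thesis
    by (simp add: Phibar_quot_def field_simps)
qed (simp add: Phibar_quot_def)

lemma upper_cost_has_derivative:
  assumes "0 < k"
  shows "(upper_cost c p has_real_derivative c - p * loss_slope k) (at k)"
  unfolding upper_cost_def using assms
  by (auto intro!: derivative_eq_intros G_has_derivative Phibar_quot_has_derivative)
    (simp add: loss_slope_def G_eq field_simps)

text \<open>The derivative \<open>c - p * loss_slope k\<close> changes sign at the root of \<open>loss_slope k = c / p\<close> when \<open>c / p\<close>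
  is below \<open>1/2\<close>, and is positive for all positive \<open>k\<close> otherwise, so that the minimum is at \<open>0\<close>.
  The derivative need not vanish there, but the equation holds, both sides being \<open>p * \<phi> 0\<close>.\<close>

lemma upper_cost_strict_min:
  assumes "0 < c" "c < p"
  obtains m where "0 \<le> m"
    "\<And>k. 0 \<le> k \<Longrightarrow> k \<noteq> m \<Longrightarrow> upper_cost c p m < upper_cost c p k"
    "c * m + p * G m = p * Phibar_quot m"
    "Phibar m \<le> c / p"
proof -
  have "0 < p" using assms by simp
  have "continuous_on {0..} (upper_cost c p)"
  proof (intro continuous_at_imp_continuous_on ballI)
    fix x :: real assume "x \<in> {0..}"
    show "isCont (upper_cost c p) x"
    proof (cases "x = 0")
      case True
      then show ?thesis
        unfolding upper_cost_def
        by (intro continuous_intros) (auto intro: Phibar_quot_isCont_0 DERIV_isCont[OF G_has_derivative])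
    qed (use \<open>x \<in> {0..}\<close> in \<open>auto intro: DERIV_isCont[OF upper_cost_has_derivative]\<close>)
  qed
  note strict_min = strict_min_by_derivative_sign[where S = "{0..}", OF _ _ this,
      of _ "\<lambda>x. c - p * loss_slope x", OF _ _ upper_cost_has_derivative]
  show ?thesis
  proof (cases "c / p < 1 / 2")
    case True
    then obtain m where m: "0 < m" "loss_slope m = c / p"
      using loss_slope_surj_lower_half[of "c / p"] assms by auto
    then have c: "c = p * loss_slope m" using \<open>0 < p\<close> by simp
    show ?thesis
    proof (rule that[of m])
      show "upper_cost c p m < upper_cost c p k" if "0 \<le> k" "k \<noteq> m" for k
        by (rule strict_min)
          (use m that c \<open>0 < p\<close> loss_slope_strict_antimono in \<open>auto simp: is_interval_ci\<close>)
      have "c * m = p * (Phibar_quot m - G m)"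
        using m(1) arg_cong[OF c, of "\<lambda>x. x * m"] by (simp add: loss_slope_def)
      then show "c * m + p * G m = p * Phibar_quot m"
        by (simp add: algebra_simps)
      show "Phibar m \<le> c / p"
        using loss_slope_gt_Phibar[OF m(1)] m(2) by simp
    qed (use m in simp)
  next
    case False
    then have c: "p / 2 \<le> c" using \<open>0 < p\<close> by (simp add: field_simps)
    show ?thesis
    proof (rule that[of 0])
      show "upper_cost c p 0 < upper_cost c p k" if "0 \<le> k" "k \<noteq> 0" for k
      proof (rule strict_min)
        show "0 < c - p * loss_slope x" if "0 < x" for x
          using mult_strict_left_mono[OF loss_slope_less_half[OF that] \<open>0 < p\<close>] c by simp
      qed (use that in \<open>auto simp: is_interval_ci\<close>)
      show "Phibar 0 \<le> c / p" using False by (simp add: Phibar_0)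
    qed (auto simp: G_eq Phibar_quot_def)
  qed
qed

section \<open>The sum in Spitzer's identity\<close>

text \<open>The difference of the values at \<open>b\<close> and \<open>a\<close> of \<open>t * (Phibar_quot (\<mu> * t) + G (\<mu> * t))\<close> is twice the
  integral of \<open>G (\<mu> * t)\<close> from \<open>a\<close> to \<open>b\<close>, and \<open>G\<close> is decreasing.\<close>

lemma G_chord_bound:
  assumes "0 \<le> \<mu>" "0 \<le> a" "a \<le> b"
  shows "2 * (b - a) * G (\<mu> * b) + a * (Phibar_quot (\<mu> * a) + G (\<mu> * a))
    \<le> b * (Phibar_quot (\<mu> * b) + G (\<mu> * b))"
proof (cases "\<mu> = 0")
  case True
  then show ?thesis by (simp add: G_eq Phibar_quot_def algebra_simps)
next
  case False
  then have "0 < \<mu>" using assms by simp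
  \<comment> \<open>\<open>J / 2\<close> is the antiderivative of \<open>G\<close> that vanishes at \<open>0\<close>\<close>
  define J where "J x = 1 / 2 - Phibar x + x * G x" for x
  have J: "\<mu> * (t * (Phibar_quot (\<mu> * t) + G (\<mu> * t))) = J (\<mu> * t)" for t
    using \<open>0 < \<mu>\<close> by (cases "t = 0") (auto simp: J_def Phibar_quot_def Phibar_0 field_simps)
  have deriv: "((\<lambda>x. J x - 2 * G (\<mu> * b) * x) has_real_derivative 2 * G x - 2 * G (\<mu> * b)) (at x)" for x
    unfolding J_def
    by (auto intro!: derivative_eq_intros Phibar_has_derivative G_has_derivative)
      (simp add: G_eq algebra_simps)
  have "J (\<mu> * a) - 2 * G (\<mu> * b) * (\<mu> * a) \<le> J (\<mu> * b) - 2 * G (\<mu> * b) * (\<mu> * b)"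
  proof (rule DERIV_nonneg_imp_nondecreasing[where f = "\<lambda>x. J x - 2 * G (\<mu> * b) * x"])
    show "\<mu> * a \<le> \<mu> * b" using assms by (intro mult_left_mono) auto
    show "\<exists>y. ((\<lambda>x. J x - 2 * G (\<mu> * b) * x) has_real_derivative y) (at x) \<and> 0 \<le> y"
      if "x \<le> \<mu> * b" for x
      using deriv[of x] G_antimono[OF that] by (intro exI[of _ "2 * G x - 2 * G (\<mu> * b)"]) simp
  qed
  then have "\<mu> * (2 * (b - a) * G (\<mu> * b) + a * (Phibar_quot (\<mu> * a) + G (\<mu> * a)))
    \<le> \<mu> * (b * (Phibar_quot (\<mu> * b) + G (\<mu> * b)))"
    using J[of a] J[of b] by (simp add: algebra_simps)
  then show ?thesis using \<open>0 < \<mu>\<close> by simp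
qed

text \<open>Comparison of the sum with the integral of a decreasing function. With the substitution
  \<open>u = sqrt t\<close> the integral of \<open>G (\<mu> * sqrt t) / sqrt t\<close> becomes twice that of \<open>G (\<mu> * u)\<close>, so each
  increment is handled by \<open>G_chord_bound\<close>.\<close>

lemma sum_G_sqrt_le:
  fixes N :: nat
  assumes "0 \<le> \<mu>"
  shows "(\<Sum>n=1..N. G (\<mu> * sqrt n) / sqrt n)
    \<le> sqrt N * (Phibar_quot (\<mu> * sqrt N) + G (\<mu> * sqrt N))"
proof (induction N)
  case (Suc N)
  define a b where "a = sqrt N" and "b = sqrt (Suc N)"
  have ab: "0 \<le> a" "a \<le> b" "0 < b" by (auto simp: a_def b_def)
  have "b\<^sup>2 - a\<^sup>2 = 1" by (simp add: a_def b_def)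
  then have "1 = (b - a) * (b + a)" by (simp add: power2_eq_square algebra_simps)
  also have "\<dots> \<le> (b - a) * (2 * b)" using ab by (intro mult_left_mono) auto
  finally have "1 / b \<le> 2 * (b - a)" using ab by (simp add: field_simps)
  then have "G (\<mu> * b) / b \<le> 2 * (b - a) * G (\<mu> * b)"
    using mult_right_mono[OF _ G_nonneg[of "\<mu> * b"]] by fastforce
  with G_chord_bound[OF assms ab(1,2)] Suc show ?case
    by (simp add: a_def b_def)
qed simp

section \<open>Bounds on the expected lost sales\<close>

lemma (in prob_space) std_normal_integrable:
  assumes "distributed M lborel X std_normal_density"
  shows "integrable M X"
  using distributed_integrable[OF assms, of "\<lambda>x. x"] integrable_std_normal_moment[of 1] by simp

lemma (in prob_space) std_normal_walk_excess:
  fixes Z :: "nat \<Rightarrow> 'a \<Rightarrow> real" and n :: nat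
  assumes indep: "indep_vars (\<lambda>_. borel) Z {1..}"
    and normal: "\<And>i. 1 \<le> i \<Longrightarrow> distributed M lborel (Z i) std_normal_density"
    and "0 < \<sigma>" "1 \<le> n"
  shows "expectation (\<lambda>\<omega>. max 0 (\<sigma> * (\<Sum>i=1..n. Z i \<omega>) - d)) =
    \<sigma> * sqrt n * G (d / (\<sigma> * sqrt n))"
proof -
  let ?s = "\<sigma> * sqrt n"
  let ?W = "\<lambda>\<omega>. (\<Sum>i=1..n. Z i \<omega>) / sqrt n"
  have pos: "0 < ?s" using assms by simp
  have "distributed M lborel (\<lambda>\<omega>. \<Sum>i\<in>{1..n}. Z i \<omega>)
    (normal_density (\<Sum>i\<in>{1..n}. 0) (sqrt (\<Sum>i\<in>{1..n}. 1\<^sup>2)))"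
    by (rule sum_indep_normal) (use assms in \<open>auto intro: indep_vars_subset\<close>)
  then have "distributed M lborel (\<lambda>\<omega>. \<Sum>i=1..n. Z i \<omega>) (normal_density 0 (sqrt n))"
    by simp
  then have W: "distributed M lborel ?W std_normal_density"
    using normal_standard_normal_convert[of "sqrt n" "\<lambda>\<omega>. \<Sum>i=1..n. Z i \<omega>" 0] \<open>1 \<le> n\<close> by simp
  have scale: "max 0 (\<sigma> * (\<Sum>i=1..n. Z i \<omega>) - d) = ?s * max 0 (?W \<omega> - d / ?s)" for \<omega>
  proof -
    have "\<sigma> * (\<Sum>i=1..n. Z i \<omega>) - d = ?s * (?W \<omega> - d / ?s)"
      using \<open>0 < \<sigma>\<close> \<open>1 \<le> n\<close> by (simp add: right_diff_distrib)
    then show ?thesis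
      using pos by (simp add: max_mult_distrib_left)
  qed
  have "expectation (\<lambda>\<omega>. max 0 (?W \<omega> - d / ?s)) = (LINT x|lborel. \<phi> x * max 0 (x - d / ?s))"
    by (rule distributed_integral[OF W, symmetric]) auto
  also have "\<dots> = G (d / ?s)"
    unfolding G_def by (subst integral_density) auto
  finally show ?thesis
    unfolding scale by simp
qed

text \<open>Keep only the times \<open>0\<close> and \<open>N\<close> in the maximum.\<close>

lemma (in prob_space) expected_lost_sales_ge:
  assumes indep: "indep_vars (\<lambda>_. borel) Z {1..}"
    and normal: "\<And>i. 1 \<le> i \<Longrightarrow> distributed M lborel (Z i) std_normal_density"
    and "0 < \<sigma>" "1 \<le> N"
  shows "\<sigma> * sqrt N * G (\<kappa> * N powr \<alpha> / sqrt N) \<le> expectation (lost_sales Z \<sigma> \<alpha> \<kappa> N)"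
proof -
  have iZ: "integrable M (Z i)" if "1 \<le> i" for i
    using std_normal_integrable[OF normal[OF that]] .
  have walk: "integrable M (walk Z \<sigma> \<alpha> \<kappa> j)" for j
  proof (cases "j = 0")
    case False
    then show ?thesis
      unfolding walk_def[abs_def] if_not_P[OF False]
      by (intro Bochner_Integration.integrable_diff integrable_mult_right
          Bochner_Integration.integrable_sum iZ) auto
  qed (simp add: walk_def[abs_def])
  have "\<sigma> * sqrt N * G (\<kappa> * N powr \<alpha> / sqrt N) =
    expectation (\<lambda>\<omega>. max 0 (\<sigma> * (\<Sum>i=1..N. Z i \<omega>) - \<kappa> * \<sigma> * N powr \<alpha>))"
    using std_normal_walk_excess[OF indep normal \<open>0 < \<sigma>\<close> \<open>1 \<le> N\<close>, of "\<kappa> * \<sigma> * N powr \<alpha>"] \<open>0 < \<sigma>\<close>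
    by simp
  also have "\<dots> = expectation (\<lambda>\<omega>. max (walk Z \<sigma> \<alpha> \<kappa> 0 \<omega>) (walk Z \<sigma> \<alpha> \<kappa> N \<omega>))"
    using \<open>1 \<le> N\<close> by (simp add: walk_def)
  also have "\<dots> \<le> expectation (lost_sales Z \<sigma> \<alpha> \<kappa> N)"
  proof (rule integral_mono)
    show "integrable M (lost_sales Z \<sigma> \<alpha> \<kappa> N)"
      unfolding lost_sales_def[abs_def] by (rule integrable_Max) (auto intro: walk)
    show "max (walk Z \<sigma> \<alpha> \<kappa> 0 \<omega>) (walk Z \<sigma> \<alpha> \<kappa> N \<omega>) \<le> lost_sales Z \<sigma> \<alpha> \<kappa> N \<omega>" for \<omega>
      unfolding lost_sales_def by (intro max.boundedI Max_ge) auto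
  qed (use walk in auto)
  finally show ?thesis .
qed

text \<open>For \<open>\<alpha> = 1\<close> the drift is linear, so the walk has i.i.d. increments and Spitzer's identity applies.
  The scaling \<open>k / sqrt N\<close> puts the total drift on the scale \<open>\<sigma> * sqrt N\<close> of the noise.\<close>

lemma (in prob_space) expected_lost_sales_linear_le:
  assumes indep: "indep_vars (\<lambda>_. borel) Z {1..}"
    and normal: "\<And>i. 1 \<le> i \<Longrightarrow> distributed M lborel (Z i) std_normal_density"
    and "0 < \<sigma>" "1 \<le> N" "0 \<le> k"
  shows "expectation (lost_sales Z \<sigma> 1 (k / sqrt N) N) \<le> \<sigma> * sqrt N * (Phibar_quot k + G k)"
proof -
  \<comment> \<open>the drift per period in units of \<open>\<sigma>\<close>\<close>
  define \<mu> where "\<mu> = k / sqrt N"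
  define X where "X i \<omega> = \<sigma> * Z i \<omega> - \<mu> * \<sigma>" for i \<omega>
  have k: "\<mu> * sqrt N = k" using \<open>1 \<le> N\<close> by (simp add: \<mu>_def)
  have "0 \<le> \<mu>" using \<open>0 \<le> k\<close> by (simp add: \<mu>_def)
  have sum_X: "(\<Sum>i=1..n. X i \<omega>) = \<sigma> * (\<Sum>i=1..n. Z i \<omega>) - \<mu> * \<sigma> * n" for n \<omega>
    by (simp add: X_def sum_subtractf sum_distrib_left)
  have "walk Z \<sigma> 1 \<mu> n \<omega> = (\<Sum>i=1..n. X i \<omega>)" for n \<omega>
    by (simp add: walk_def sum_X del: One_nat_def)
  then have L: "lost_sales Z \<sigma> 1 \<mu> N = (\<lambda>\<omega>. running_max N (\<lambda>i. X i \<omega>))"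
    by (intro ext) (simp add: lost_sales_def running_max_def)
  have "expectation (\<lambda>\<omega>. running_max N (\<lambda>i. X i \<omega>)) =
    (\<Sum>n=1..N. expectation (\<lambda>\<omega>. max 0 (\<Sum>i=1..n. X i \<omega>)) / n)"
  proof (rule spitzer_expected_max)
    show "indep_vars (\<lambda>_. borel) X {1..N}"
      unfolding X_def[abs_def]
      by (rule indep_vars_compose2[OF indep_vars_subset[OF indep]]) auto
    fix i assume i: "i \<in> {1..N}"
    then have "1 \<le> i" by simp
    then have Z: "distr M lborel (Z i) = std_normal_distribution" "random_variable lborel (Z i)"
      using normal by (auto simp: distributed_def)
    have "distr M borel (X i) = distr (distr M lborel (Z i)) borel (\<lambda>z. \<sigma> * z - \<mu> * \<sigma>)"
      unfolding X_def[abs_def] using Z(2) by (subst distr_distr) (auto simp: comp_def)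
    then show "distr M borel (X i) = distr std_normal_distribution borel (\<lambda>z. \<sigma> * z - \<mu> * \<sigma>)"
      by (simp only: Z(1))
    show "integrable M (X i)"
      unfolding X_def[abs_def] using std_normal_integrable[OF normal[OF \<open>1 \<le> i\<close>]] by simp
  qed
  also have "\<dots> = (\<Sum>n=1..N. \<sigma> * (G (\<mu> * sqrt n) / sqrt n))"
  proof (rule sum.cong[OF refl])
    fix n assume "n \<in> {1..N}"
    then have n: "1 \<le> n" by simp
    have "\<mu> * \<sigma> * n / (\<sigma> * sqrt n) = \<mu> * (n / sqrt n)"
      using \<open>0 < \<sigma>\<close> by simp
    then have "\<mu> * \<sigma> * n / (\<sigma> * sqrt n) = \<mu> * sqrt n"
      by (simp only: real_div_sqrt[OF of_nat_0_le_iff])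
    then have "expectation (\<lambda>\<omega>. max 0 (\<Sum>i=1..n. X i \<omega>)) = \<sigma> * sqrt n * G (\<mu> * sqrt n)"
      using std_normal_walk_excess[OF indep normal \<open>0 < \<sigma>\<close> n, of "\<mu> * \<sigma> * n"]
      by (simp only: sum_X)
    then show "expectation (\<lambda>\<omega>. max 0 (\<Sum>i=1..n. X i \<omega>)) / n = \<sigma> * (G (\<mu> * sqrt n) / sqrt n)"
      using n by (simp add: field_simps del: One_nat_def)
  qed
  also have "\<dots> \<le> \<sigma> * (sqrt N * (Phibar_quot k + G k))"
    unfolding sum_distrib_left[symmetric]
    using sum_G_sqrt_le[OF \<open>0 \<le> \<mu>\<close>, of N] \<open>0 < \<sigma>\<close> unfolding k by (intro mult_left_mono) auto
  finally show ?thesis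
    by (simp add: L \<mu>_def[symmetric] mult.assoc)
qed

text \<open>The hypothesis on \<open>v\<close> serves the second bound too: it makes the set of costs bounded below, without
  which the real infimum in \<open>V_star\<close> would say nothing about its members.\<close>

lemma (in prob_space) V_star_bounds:
  assumes indep: "indep_vars (\<lambda>_. borel) Z {1..}"
    and normal: "\<And>i. 1 \<le> i \<Longrightarrow> distributed M lborel (Z i) std_normal_density"
    and pos: "0 < \<sigma>" "0 < p" "1 \<le> N"
    and lower: "\<And>y. v \<le> lower_cost c p y"
  shows "v \<le> V_star M Z \<sigma> c p N"
    and "0 \<le> k \<Longrightarrow> V_star M Z \<sigma> c p N \<le> upper_cost c p k"
proof -
  let ?s = "\<sigma> * sqrt N"
  let ?cost = "\<lambda>(\<alpha>, \<kappa>). c * \<sigma> * \<kappa> * N powr \<alpha> + p * expectation (lost_sales Z \<sigma> \<alpha> \<kappa> N)"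
  let ?D = "{0..1} \<times> UNIV :: (real \<times> real) set"
  have s: "0 < ?s" using pos by simp
  have V: "V_star M Z \<sigma> c p N = 1 / ?s * (INF x \<in> ?D. ?cost x)"
    by (simp add: V_star_def)
  have ge: "?s * v \<le> ?cost (\<alpha>, \<kappa>)" for \<alpha> \<kappa>
  proof -
    let ?y = "\<kappa> * N powr \<alpha> / sqrt N"
    have "?s * v \<le> ?s * lower_cost c p ?y"
      using lower s by (intro mult_left_mono) auto
    also have "\<dots> = c * \<sigma> * \<kappa> * N powr \<alpha> + p * (?s * G ?y)"
      using \<open>1 \<le> N\<close> by (simp add: lower_cost_def algebra_simps)
    also have "\<dots> \<le> ?cost (\<alpha>, \<kappa>)"
      using expected_lost_sales_ge[OF indep normal pos(1,3), of \<kappa> \<alpha>] \<open>0 < p\<close> by simp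
    finally show ?thesis .
  qed
  have "?s * v \<le> (INF x \<in> ?D. ?cost x)"
    by (rule cINF_greatest) (use ge in auto)
  then show "v \<le> V_star M Z \<sigma> c p N"
    unfolding V using s by (simp add: field_simps)
  assume "0 \<le> k"
  have "(INF x \<in> ?D. ?cost x) \<le> ?cost (1, k / sqrt N)"
    by (rule cINF_lower) (use ge in \<open>auto intro!: bdd_belowI2[where m = "?s * v"]\<close>)
  also have "\<dots> \<le> c * \<sigma> * (k / sqrt N) * N + p * (?s * (Phibar_quot k + G k))"
    using expected_lost_sales_linear_le[OF indep normal pos(1,3) \<open>0 \<le> k\<close>] \<open>0 < p\<close> by simp
  also have "c * \<sigma> * (k / sqrt N) * N = ?s * (c * k)"
    using \<open>1 \<le> N\<close> by (simp add: field_simps)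
  finally have "(INF x \<in> ?D. ?cost x) \<le> ?s * upper_cost c p k"
    by (simp add: upper_cost_def algebra_simps)
  then show "V_star M Z \<sigma> c p N \<le> upper_cost c p k"
    unfolding V using s by (simp add: field_simps)
qed

section \<open>Comparison of the three values\<close>

lemma cINF_attained:
  fixes f :: "'b \<Rightarrow> real"
  assumes "m \<in> A" "\<And>x. x \<in> A \<Longrightarrow> f m \<le> f x"
  shows "(INF x\<in>A. f x) = f m"
  using assms by (intro cInf_eq_minimum) auto

theorem proposition10:
  fixes M :: "'a measure" and Z :: "nat \<Rightarrow> 'a \<Rightarrow> real"
    and \<sigma> c p :: real and N :: nat
  assumes "prob_space M"
    and "prob_space.indep_vars M (\<lambda>_. borel) Z {1..}"
    and "\<And>i. 1 \<le> i \<Longrightarrow> distributed M lborel (Z i) std_normal_density"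
    and "0 < \<sigma>" and "0 < c" and "c < p" and "1 \<le> N"
  shows
    "(\<forall>y. Phibar y = c / p \<longleftrightarrow> y = kappa_lower c p) \<and>
     (\<forall>y. is_arg_min (lower_cost c p) (\<lambda>_. True) y \<longleftrightarrow> y = kappa_lower c p) \<and>
     V_lower c p = p * std_normal_density (kappa_lower c p) \<and>
     (\<forall>k. is_arg_min (upper_cost c p) (\<lambda>k. 0 \<le> k) k \<longleftrightarrow> k = kappa_upper c p) \<and>
     c * kappa_upper c p + p * G (kappa_upper c p) = p * Phibar_quot (kappa_upper c p) \<and>
     kappa_lower c p \<le> kappa_upper c p \<and>
     V_upper c p / V_lower c p =
       2 * (c * kappa_upper c p + p * G (kappa_upper c p)) /
       (c * kappa_lower c p + p * G (kappa_lower c p)) \<and>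
     V_upper c p / V_lower c p =
       2 * Phibar_quot (kappa_upper c p) / std_normal_density (kappa_lower c p) \<and>
     2 \<le> V_upper c p / V_lower c p \<and>
     V_upper c p / V_lower c p \<le>
       2 * std_normal_density 0 / std_normal_density (kappa_lower c p) \<and>
     V_lower c p / V_upper c p \<le> V_lower c p / V_star M Z \<sigma> c p N \<and>
     V_lower c p / V_star M Z \<sigma> c p N \<le> V_upper c p / V_star M Z \<sigma> c p N \<and>
     V_upper c p / V_star M Z \<sigma> c p N \<le> V_upper c p / V_lower c p"
proof -
  interpret prob_space M by fact
  have "0 < p" using assms by simp
  define l u where "l = kappa_lower c p" and "u = kappa_upper c p"

  have inj: "Phibar x = Phibar y \<longleftrightarrow> x = y" for x y
    using Phibar_strict_antimono[of x y] Phibar_strict_antimono[of y x]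
    by (cases x y rule: linorder_cases) auto
  obtain l' where l': "Phibar l' = c / p"
    using Phibar_surj_unit_interval[of "c / p"] assms by auto
  have "inj Phibar" by (auto intro: injI simp: inj)
  then have "l = l'" using l' inv_f_f[of Phibar l'] by (simp add: l_def kappa_lower_def)
  with l' have l: "Phibar l = c / p" by simp
  have l_iff: "Phibar y = c / p \<longleftrightarrow> y = l" for y
    unfolding l[symmetric] by (rule inj)
  have l_min: "lower_cost c p l < lower_cost c p y" if "y \<noteq> l" for y
    using lower_cost_strict_min[OF \<open>0 < p\<close> l that] .
  have l_min': "lower_cost c p l \<le> lower_cost c p y" for y
    using l_min[of y] by (cases "y = l") auto
  have l_arg_min: "is_arg_min (lower_cost c p) (\<lambda>_. True) y \<longleftrightarrow> y = l" for y
    using l_min l_min' by (auto simp: is_arg_min_linorder) (metis not_le)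
  have Vl_cost: "V_lower c p = lower_cost c p l"
    unfolding V_lower_def by (rule cINF_attained) (use l_min' in auto)
  have Vl: "V_lower c p = p * \<phi> l"
    using l \<open>0 < p\<close> unfolding Vl_cost by (simp add: lower_cost_def G_eq field_simps)

  obtain m where m: "0 \<le> m"
    "\<And>k. 0 \<le> k \<Longrightarrow> k \<noteq> m \<Longrightarrow> upper_cost c p m < upper_cost c p k"
    "c * m + p * G m = p * Phibar_quot m" "Phibar m \<le> c / p"
    by (rule upper_cost_strict_min[OF assms(5,6)]) (rule that)
  have m_min: "upper_cost c p m \<le> upper_cost c p k" if "0 \<le> k" for k
    using m(2)[OF that] by (cases "k = m") auto
  have m_arg_min: "is_arg_min (upper_cost c p) (\<lambda>k. 0 \<le> k) k \<longleftrightarrow> k = m" for k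
    using m(1,2) m_min by (auto simp: is_arg_min_linorder) (metis not_le)
  have "u = m"
    unfolding u_def kappa_upper_def arg_min_def by (rule some_equality) (simp_all add: m_arg_min)
  have Vu_cost: "V_upper c p = upper_cost c p m"
    unfolding V_upper_def by (rule cINF_attained) (use m m_min in auto)
  have Vu: "V_upper c p = 2 * (p * Phibar_quot m)"
    using m(3) unfolding Vu_cost by (simp add: upper_cost_def algebra_simps)

  have "l \<le> m"
    using m(4) l Phibar_strict_antimono[of m l] by (cases "l \<le> m") auto
  have "0 < \<phi> l" by (rule normal_density_pos) simp
  then have Vl_pos: "0 < V_lower c p" using Vl \<open>0 < p\<close> by simp
  have ratio: "V_upper c p / V_lower c p = 2 * Phibar_quot m / \<phi> l"
    using \<open>0 < p\<close> by (simp add: Vu Vl)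
  have "2 * V_lower c p \<le> V_upper c p"
    using l_min'[of m] m(3) by (simp add: Vl_cost Vu lower_cost_def)
  then have ratio_ge: "2 \<le> V_upper c p / V_lower c p"
    using Vl_pos by (simp add: field_simps)
  have ratio_le: "V_upper c p / V_lower c p \<le> 2 * \<phi> 0 / \<phi> l"
    using Phibar_quot_le[OF m(1)] \<open>0 < \<phi> l\<close> unfolding ratio by (simp add: divide_right_mono)
  have lV: "V_lower c p \<le> V_star M Z \<sigma> c p N"
    using V_star_bounds(1)[OF assms(2,3,4) \<open>0 < p\<close> assms(7) l_min'] by (simp add: Vl_cost)
  have Vu': "V_star M Z \<sigma> c p N \<le> V_upper c p"
    using V_star_bounds(2)[OF assms(2,3,4) \<open>0 < p\<close> assms(7) l_min' m(1)] by (simp add: Vu_cost)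
  have "V_lower c p / V_upper c p \<le> V_lower c p / V_star M Z \<sigma> c p N"
    "V_lower c p / V_star M Z \<sigma> c p N \<le> V_upper c p / V_star M Z \<sigma> c p N"
    "V_upper c p / V_star M Z \<sigma> c p N \<le> V_upper c p / V_lower c p"
    using lV Vu' Vl_pos by (auto intro!: divide_left_mono divide_right_mono)
  moreover have "V_upper c p / V_lower c p = 2 * (c * m + p * G m) / (c * l + p * G l)"
    unfolding m(3) Vu Vl_cost lower_cost_def ..
  ultimately show ?thesis
    unfolding l_def[symmetric] u_def[symmetric] \<open>u = m\<close>
    using l_iff l_arg_min Vl m_arg_min m(3) \<open>l \<le> m\<close> ratio ratio_ge ratio_le by blast
qed

end
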